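(* Let $\mathsf{n}$ be a linearly dependent tuple of linear subspaces of a finite-dimensional vector space $V$ over a field $\mathbb{K}$, and let $\mathsf{b}$ be a basis of the Minkowski matroid $\mathsf{M}(\mathsf{n})$. Then $\mathsf{b}$ contains a unique BK-subtuple that is maximal by inclusion among the BK-subtuples of $\mathsf{b}$.
   Context: A tuple is a finite indexed family of linear subspaces of $V$ (repetitions allowed); a subtuple is a subfamily indexed by a subset of the index set. For a tuple $\mathsf{k}$, $\langle\mathsf{k}\rangle=\sum_{L\in\mathsf{k}}L$ (zero for the empty tuple), $\mathfrak{c}(\mathsf{k})$ is the number of its entries, and $\delta(\mathsf{k})=\dim\langle\mathsf{k}\rangle-\mathfrak{c}(\mathsf{k})$ is its defect. A tuple is linearly independent if every subtuple (including itself) has non-negative defect, and linearly dependent otherwise. A BK-tuple is a linearly independent tuple with defect $0$. The Minkowski matroid $\mathsf{M}(\mathsf{n})$ has ground set the entries (indices) of $\mathsf{n}$ and independent sets the linearly independent subtuples; a basis is a maximal linearly independent subtuple. *)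

theory Defs
  imports Complex_Main
begin

text \<open>
  A tuple of linear subspaces is given by a finite index set \<open>I\<close> and a family \<open>n\<close> such that
  \<open>n i\<close> is a subspace for every \<open>i \<in> I\<close>; repetitions are allowed since \<open>n\<close> need not be injective.
  The subtuple indexed by \<open>J \<subseteq> I\<close> is represented by the same family \<open>n\<close> together with \<open>J\<close>, so
  inclusion of subtuples is inclusion of index sets, and the values of \<open>n\<close> outside the index set
  are irrelevant. The scalar multiplication of the vector space is an explicit parameter.
\<close>

definition subspace_tuple ::
  "('k::field \<Rightarrow> 'v::ab_group_add \<Rightarrow> 'v) \<Rightarrow> ('i \<Rightarrow> 'v set) \<Rightarrow> 'i set \<Rightarrow> bool"
  where "subspace_tuple scale n I \<longleftrightarrow> finite I \<and> (\<forall>i\<in>I. module.subspace scale (n i))"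

definition tuple_sum :: "('i \<Rightarrow> 'v::ab_group_add set) \<Rightarrow> 'i set \<Rightarrow> 'v set"
  where "tuple_sum n J = {\<Sum>i\<in>J. x i | x. \<forall>i\<in>J. x i \<in> n i}"

definition defect ::
  "('k::field \<Rightarrow> 'v::ab_group_add \<Rightarrow> 'v) \<Rightarrow> ('i \<Rightarrow> 'v set) \<Rightarrow> 'i set \<Rightarrow> int"
  where "defect scale n J = int (vector_space.dim scale (tuple_sum n J)) - int (card J)"

definition tuple_independent ::
  "('k::field \<Rightarrow> 'v::ab_group_add \<Rightarrow> 'v) \<Rightarrow> ('i \<Rightarrow> 'v set) \<Rightarrow> 'i set \<Rightarrow> bool"
  where "tuple_independent scale n J \<longleftrightarrow> (\<forall>K\<subseteq>J. defect scale n K \<ge> 0)"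

abbreviation tuple_dependent ::
  "('k::field \<Rightarrow> 'v::ab_group_add \<Rightarrow> 'v) \<Rightarrow> ('i \<Rightarrow> 'v set) \<Rightarrow> 'i set \<Rightarrow> bool"
  where "tuple_dependent scale n J \<equiv> \<not> tuple_independent scale n J"

text \<open>The empty tuple is a BK-tuple.\<close>

definition BK_tuple ::
  "('k::field \<Rightarrow> 'v::ab_group_add \<Rightarrow> 'v) \<Rightarrow> ('i \<Rightarrow> 'v set) \<Rightarrow> 'i set \<Rightarrow> bool"
  where "BK_tuple scale n J \<longleftrightarrow> tuple_independent scale n J \<and> defect scale n J = 0"

text \<open>A matroid is given by its ground set and its collection of independent sets.\<close>

definition minkowski_matroid ::
  "('k::field \<Rightarrow> 'v::ab_group_add \<Rightarrow> 'v) \<Rightarrow> ('i \<Rightarrow> 'v set) \<Rightarrow> 'i set \<Rightarrow> 'i set \<times> 'i set set"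
  where "minkowski_matroid scale n I = (I, {J. J \<subseteq> I \<and> tuple_independent scale n J})"

definition maximal_by_inclusion :: "'i set \<Rightarrow> 'i set set \<Rightarrow> bool"
  where "maximal_by_inclusion J \<J> \<longleftrightarrow> J \<in> \<J> \<and> (\<forall>K\<in>\<J>. J \<subseteq> K \<longrightarrow> K = J)"

definition matroid_basis :: "'i set \<times> 'i set set \<Rightarrow> 'i set \<Rightarrow> bool"
  where "matroid_basis M B \<longleftrightarrow> maximal_by_inclusion B (snd M)"

lemma tuple_sum_empty: "tuple_sum n {} = {0}"
  by (simp add: tuple_sum_def)

lemma (in vector_space) tuple_sum_eq_span:
  assumes "subspace_tuple scale n I" and "J \<subseteq> I"
  shows "tuple_sum n J = span (\<Union>i\<in>J. n i)"
proof -
  have "finite J" using assms by (auto simp: subspace_tuple_def intro: finite_subset)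
  moreover have "\<forall>i\<in>J. subspace (n i)" using assms by (auto simp: subspace_tuple_def)
  ultimately show ?thesis
  proof (induction J rule: finite_induct)
    case empty
    then show ?case by (simp add: tuple_sum_empty)
  next
    case (insert j J)
    have "tuple_sum n (insert j J) = {x + y | x y. x \<in> n j \<and> y \<in> tuple_sum n J}"
    proof (intro subset_antisym subsetI)
      fix z assume "z \<in> tuple_sum n (insert j J)"
      then show "z \<in> {x + y | x y. x \<in> n j \<and> y \<in> tuple_sum n J}"
        using insert.hyps by (auto simp: tuple_sum_def)
    next
      fix z assume "z \<in> {x + y | x y. x \<in> n j \<and> y \<in> tuple_sum n J}"
      then obtain x f where x: "x \<in> n j" and f: "\<forall>i\<in>J. f i \<in> n i" and z: "z = x + sum f J"
        by (auto simp: tuple_sum_def)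
      let ?g = "f(j := x)"
      have "sum ?g J = sum f J"
        by (rule sum.cong) (use insert.hyps in auto)
      then have "z = sum ?g (insert j J)"
        using insert.hyps z by simp
      moreover have "\<forall>i\<in>insert j J. ?g i \<in> n i"
        using f x by auto
      ultimately show "z \<in> tuple_sum n (insert j J)"
        unfolding tuple_sum_def by blast
    qed
    also have "\<dots> = {x + y | x y. x \<in> span (n j) \<and> y \<in> span (\<Union>i\<in>J. n i)}"
    proof -
      have "span (n j) = n j"
        using insert.prems by (simp only: span_eq_iff ball_simps)
      moreover have "tuple_sum n J = span (\<Union>i\<in>J. n i)"
        using insert.IH insert.prems by blast
      ultimately show ?thesis by (simp only:)
    qed
    also have "\<dots> = span (\<Union>i\<in>insert j J. n i)"
      by (auto simp: span_Un)
    finally show ?case .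
  qed
qed

end

theory Submission
  imports Defs
begin

text \<open>
  Dimension is submodular and cardinality is modular, so the defect is submodular on subtuples.
  Inside an independent tuple the defect is non-negative, so the subtuples on which it vanishes
  are closed under union; a finite nonempty union-closed family has a unique maximal member.
\<close>

lemma (in finite_dimensional_vector_space) defect_submodular:
  assumes I: "subspace_tuple scale n I" and J: "J \<subseteq> I" and K: "K \<subseteq> I"
  shows "defect scale n (J \<union> K) + defect scale n (J \<inter> K) \<le> defect scale n J + defect scale n K"
proof -
  let ?S = "\<lambda>J. tuple_sum n J"
  have S: "?S L = span (\<Union>i\<in>L. n i)" if "L \<subseteq> I" for L
    using that by (rule tuple_sum_eq_span[OF I])
  have JK: "J \<union> K \<subseteq> I" "J \<inter> K \<subseteq> I"
    using J K by auto
  \<comment> \<open>Writing the sum over the union as a set of sums of two vectors gives the form to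
    which the dimension formula for a sum of two subspaces applies.\<close>
  have union: "?S (J \<union> K) = {x + y | x y. x \<in> ?S J \<and> y \<in> ?S K}"
    by (simp add: S J K UN_Un span_Un)
  \<comment> \<open>This inclusion can be strict: equal lines under two different indices have a
    common line, while the shared index set is empty. It is the only source of inequality; the other
    two counts are exact.\<close>
  have "?S (J \<inter> K) \<subseteq> ?S J \<inter> ?S K"
    unfolding S[OF JK(2)] S[OF J] S[OF K] by (intro Int_greatest span_mono) auto
  then have "dim (?S (J \<inter> K)) \<le> dim (?S J \<inter> ?S K)"
    by (rule dim_subset)
  moreover have "dim (?S (J \<union> K)) + dim (?S J \<inter> ?S K) = dim (?S J) + dim (?S K)"
    unfolding union by (rule dim_sums_Int) (simp_all add: S J K)
  moreover have "card (J \<union> K) + card (J \<inter> K) = card J + card K"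
    using I J K by (intro card_Un_Int[symmetric]) (auto simp: subspace_tuple_def intro: finite_subset)
  ultimately show ?thesis
    by (simp add: defect_def)
qed

lemma tuple_independent_subset:
  "tuple_independent scale n J \<Longrightarrow> K \<subseteq> J \<Longrightarrow> tuple_independent scale n K"
  by (auto simp: tuple_independent_def)

lemma (in finite_dimensional_vector_space) BK_tuple_empty: "BK_tuple scale n {}"
  by (simp add: BK_tuple_def tuple_independent_def defect_def tuple_sum_empty)

text \<open>Submodularity bounds the defects of union and intersection by a total of 0, and
  independence of the union makes both non-negative, so both vanish.\<close>

lemma (in finite_dimensional_vector_space) BK_tuple_Un:
  assumes I: "subspace_tuple scale n I" "J \<union> K \<subseteq> I"
    and ind: "tuple_independent scale n (J \<union> K)"
    and BK: "BK_tuple scale n J" "BK_tuple scale n K"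
  shows "BK_tuple scale n (J \<union> K)"
proof -
  have "defect scale n (J \<union> K) + defect scale n (J \<inter> K) \<le> 0"
    using defect_submodular[OF I(1), of J K] I(2) BK by (simp add: BK_tuple_def)
  moreover have "defect scale n (J \<union> K) \<ge> 0" "defect scale n (J \<inter> K) \<ge> 0"
    using ind by (auto simp: tuple_independent_def)
  ultimately show ?thesis
    using ind by (simp add: BK_tuple_def)
qed

lemma ex1_maximal_by_inclusion:
  assumes "finite \<J>" "\<J> \<noteq> {}"
    and Un: "\<And>J K. J \<in> \<J> \<Longrightarrow> K \<in> \<J> \<Longrightarrow> J \<union> K \<in> \<J>"
  shows "\<exists>!k. maximal_by_inclusion k \<J>"
proof (rule ex_ex1I)
  show "\<exists>k. maximal_by_inclusion k \<J>"
    using finite_has_maximal[OF assms(1,2)] by (auto simp: maximal_by_inclusion_def)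
next
  fix J K
  assume "maximal_by_inclusion J \<J>" "maximal_by_inclusion K \<J>"
  \<comment> \<open>The union is a member above both \<open>J\<close> and \<open>K\<close>, so each
    of them, being maximal, equals it.\<close>
  then have "J \<union> K = J" "J \<union> K = K"
    using Un[of J K] unfolding maximal_by_inclusion_def by blast+
  then show "J = K"
    by simp
qed

theorem theorem1p30:
  fixes scale :: "'k::field \<Rightarrow> 'v::ab_group_add \<Rightarrow> 'v"
    and Basis :: "'v set"
    and n :: "'i \<Rightarrow> 'v set"
    and I b :: "'i set"
  assumes "finite_dimensional_vector_space scale Basis"
    and "subspace_tuple scale n I"
    and "tuple_dependent scale n I"
    and "matroid_basis (minkowski_matroid scale n I) b"
  shows "\<exists>!k. maximal_by_inclusion k {J. J \<subseteq> b \<and> BK_tuple scale n J}"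
proof (rule ex1_maximal_by_inclusion)
  interpret finite_dimensional_vector_space scale Basis
    by (rule assms(1))
  have b: "b \<subseteq> I" "tuple_independent scale n b"
    using assms(4) by (auto simp: matroid_basis_def minkowski_matroid_def maximal_by_inclusion_def)
  then have "finite b"
    using assms(2) by (auto simp: subspace_tuple_def intro: finite_subset)
  then show "finite {J. J \<subseteq> b \<and> BK_tuple scale n J}"
    by simp
  \<comment> \<open>The empty subtuple has defect 0, so the family always has a member.\<close>
  show "{J. J \<subseteq> b \<and> BK_tuple scale n J} \<noteq> {}"
    using BK_tuple_empty by blast
  fix J K
  assume JK: "J \<in> {J. J \<subseteq> b \<and> BK_tuple scale n J}" "K \<in> {J. J \<subseteq> b \<and> BK_tuple scale n J}"
  \<comment> \<open>A union of independent subtuples may be dependent; here it is independent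
    because it stays inside \<open>b\<close>.\<close>
  then have "tuple_independent scale n (J \<union> K)"
    by (intro tuple_independent_subset[OF b(2)]) auto
  with JK b(1) show "J \<union> K \<in> {J. J \<subseteq> b \<and> BK_tuple scale n J}"
    by (auto intro: BK_tuple_Un[OF assms(2)])
qed

end
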